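(* Let $\Delta t>0$ and let $\boldsymbol{u}_h^n=(\rho_h^n,(\rho u)_h^n,E_h^n)^T$ and $\boldsymbol{u}_h^{n+1}=(\rho_h^{n+1},(\rho u)_h^{n+1},E_h^{n+1})^T$ in $\boldsymbol{\Pi}_h$ satisfy the fully discrete forward Euler scheme: for all $j=1,\dots,N$ and all $\boldsymbol{v}=(\zeta,\psi,\delta)^T\in\boldsymbol{\Pi}_h$, $$\int_{K_j}\boldsymbol{u}_h^{n+1}\cdot\boldsymbol{v}\,r^2dr=\int_{K_j}\boldsymbol{u}_h^n\cdot\boldsymbol{v}\,r^2dr+\Delta t\left(\mathcal{F}_j(\boldsymbol{u}_h^n,\boldsymbol{v})+s_j^{[2],\mathrm{wb}}(\boldsymbol{u}_h^n,\psi)+s_j^{[3],\mathrm{tec}}\Big(\boldsymbol{u}_h^n,\hat{\boldsymbol{f}}^{*,n},\frac{\rho_h^{n+1}-\rho_h^n}{\Delta t},\frac{\Phi_h^{n+1}+\Phi_h^n}{2},\delta\Big)\right),$$ where $\Phi_h^n,\Phi_h^{n+1}$ are the discrete potentials computed from $\rho_h^n,\rho_h^{n+1}$, $\hat{\boldsymbol{f}}^{*,n}$ is the numerical flux $\hat{\boldsymbol{f}}^*$ computed from $\boldsymbol{u}_h^n$, and $\mathcal{F}_j$, $s_j^{[2],\mathrm{wb}}$, $s_j^{[3],\mathrm{tec}}$ are as defined in the context. Assume the outer boundary conditions $\Phi_h^n(R)=\Phi_h^{n+1}(R)=0$ and $\hat{f}^{*,n,[3]}_{N+1/2}=0$. Then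 the scheme conserves total energy: $$\int_{\Omega}\Big(E_h^{n+1}+\frac12\rho_h^{n+1}\Phi_h^{n+1}\Big)r^2dr=\int_{\Omega}\Big(E_h^n+\frac12\rho_h^n\Phi_h^n\Big)r^2dr.$$
   Context: Equations. $\partial_t\boldsymbol{u}+r^{-2}\partial_r(r^2\boldsymbol{f}(\boldsymbol{u}))=\boldsymbol{s}(\boldsymbol{u},\Phi)$ with $\boldsymbol{u}=(\rho,\rho u,E)^T$, $\boldsymbol{f}(\boldsymbol{u})=(\rho u,\rho u^2+p,(E+p)u)^T$, $\boldsymbol{s}=(0,\frac{2p}{r}-\rho\,\partial_r\Phi,-\rho u\,\partial_r\Phi)^T$, ideal equation of state $p=(\gamma-1)(E-\frac12\rho u^2)$ with constant $\gamma>1$, and Poisson equation $r^{-2}\partial_r(r^2\partial_r\Phi)=4\pi G\rho$ with constant $G>0$. Superscripts $[i]$ denote the $i$-th component of a vector; the superscript $n$ on numerical quantities is the time level. From a numerical state $\boldsymbol{u}_h$, $u_h=(\rho u)_h/\rho_h$ and $p_h=(\gamma-1)(E_h-\frac12\rho_hu_h^2)$. It is understood that all states at which velocity, pressure, sound speed $c=\sqrt{\gamma p/\rho}$ or fluxes are evaluated have positive density (and positive pressure where $c$ is used). Mesh and spaces. $\Omega=[0,R]$ is partitioned into cells $K_j=[r_{j-1/2},r_{j+1/2}]$, $j=1,\dots,N$, $r_{1/2}=0$, $r_{N+1/2}=R$. Fix $k\ge1$; $\mathcal{V}_h=\{v\in L^2(\Omega): v|_{K_j}\in P^k(K_j)\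 \forall j\}$ ($P^k$: polynomials of degree at most $k$), $\boldsymbol{\Pi}_h=\mathcal{V}_h^3$. Left and right limits at $r_{j+1/2}$ are denoted by $\psi^-_{j+1/2}$, $\psi^+_{j+1/2}$; $g|_{r_{j-1/2}^+}^{r_{j+1/2}^-}=g^-_{j+1/2}-g^+_{j-1/2}$, where numerical fluxes take their (single) interface values. Gauss--Radau projection. For a function $u$, $Pu\in\mathcal{V}_h$ is defined on every cell by $\int_{K_j}Pu\,\psi\,dr=\int_{K_j}u\,\psi\,dr$ for all $\psi\in P^{k-1}(K_j)$ and $Pu(r_{j-1/2}^+)=u(r_{j-1/2}^+)$; it acts componentwise on vectors. Gravitational potential. For a density $\rho_h\in\mathcal{V}_h$, $\frac{\partial\Phi_h}{\partial r}(r)=\frac{4\pi G}{r^2}\int_0^r\rho_h\tau^2\,d\tau$ with $\frac{\partial\Phi_h}{\partial r}(0)=0$, and $\Phi_h(r)=\Phi_h(R)-\int_r^R\frac{\partial\Phi_h}{\partial r}\,dr$, where $\Phi_h(R)$ is prescribed (all integrals exact). Lane--Emden function. With polytropic index $m=1/(\gamma-1)$, $\theta$ solves $\xi^{-2}\partial_\xi(\xi^2\partial_\xi\theta)=-\theta^m$, $\theta(0)=1$, $\theta'(0)=0$. Equilibrium recovery. Given $\boldsymbol{u}_h$, let $\rho_0,p_0$ be the density and pressure of $\boldsymbol{u}_h$ at $r=0$, $\kappa_0=p_0/\rho_0^\gamma$, $\alpha=\sqrt{\frac{\gamma}{\gamma-1}\kappa_0\rho_0^{\gamma-2}/(4\pi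 G)}$, and $$\boldsymbol{u}^d(r)=\Big(\rho_0\,\theta(r/\alpha)^{1/(\gamma-1)},\;0,\;\tfrac{\kappa_0}{\gamma-1}\rho_0^\gamma\,\theta(r/\alpha)^{\gamma/(\gamma-1)}\Big)^T,$$ with density $\rho^d$ and pressure $p^d=\kappa_0(\rho^d)^\gamma$ (assumed well defined on $[0,R]$). Set $\boldsymbol{u}_h^e=P\boldsymbol{u}^d$ (with density $\rho_h^e$ and pressure $p_h^e$ computed from $\boldsymbol{u}_h^e$), $\boldsymbol{u}_h^f=\boldsymbol{u}_h-\boldsymbol{u}_h^e$, $\frac{\partial\Phi_h^e}{\partial r}=\frac{4\pi G}{r^2}\int_0^r\rho_h^e\tau^2\,d\tau$. Numerical flux. $\hat{\boldsymbol{f}}^*_{j+1/2}=\hat{\boldsymbol{f}}(\boldsymbol{u}^{*,-}_{h,j+1/2},\boldsymbol{u}^{*,+}_{h,j+1/2})$, where $\boldsymbol{u}^{*,\pm}_{h,j+1/2}=\boldsymbol{u}^d(r_{j+1/2})+\boldsymbol{u}^{f,\pm}_{h,j+1/2}$ (exterior values at the domain boundary are supplied by boundary conditions). $\hat{\boldsymbol{f}}$ is the HLLC flux $$\hat{\boldsymbol{f}}(\boldsymbol{u}^-,\boldsymbol{u}^+)=\begin{cases}\boldsymbol{f}(\boldsymbol{u}^-)&0\le S^-,\\ \boldsymbol{f}(\boldsymbol{u}^-)+S^-(\boldsymbol{u}_*^--\boldsymbol{u}^-)&S^-\le0\le S^*,\\ \boldsymbol{f}(\boldsymbol{u}^+)+S^+(\boldsymbol{u}_*^+-\boldsymbol{u}^+)&S^*\le0\le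 S^+,\\ \boldsymbol{f}(\boldsymbol{u}^+)&0\ge S^+,\end{cases}$$ with $S^-=\min\{u^--c^-,u^+-c^+\}$, $S^+=\max\{u^-+c^-,u^++c^+\}$, $S^*=\frac{p^+-p^-+\rho^-u^-(S^--u^-)-\rho^+u^+(S^+-u^+)}{\rho^-(S^--u^-)-\rho^+(S^+-u^+)}$ and $$\boldsymbol{u}_*^\pm=\rho^\pm\frac{S^\pm-u^\pm}{S^\pm-S^*}\Big(1,\;S^*,\;\tfrac{E^\pm}{\rho^\pm}+(S^*-u^\pm)\big(S^*+\tfrac{p^\pm}{\rho^\pm(S^\pm-u^\pm)}\big)\Big)^T.$$ Scheme operators. For $\boldsymbol{v}=(\zeta,\psi,\delta)^T$, $$\mathcal{F}_j(\boldsymbol{u}_h,\boldsymbol{v})=-r_{j+1/2}^2\hat{\boldsymbol{f}}^*_{j+1/2}\cdot\boldsymbol{v}^-_{j+1/2}+r_{j-1/2}^2\hat{\boldsymbol{f}}^*_{j-1/2}\cdot\boldsymbol{v}^+_{j-1/2}+\int_{K_j}\boldsymbol{f}(\boldsymbol{u}_h)\cdot(\partial_r\boldsymbol{v})\,r^2dr,$$ $$s_j^{[2],\mathrm{wb}}(\boldsymbol{u}_h,\psi)=\int_{K_j}\Big(\frac{2p_h}{r}-\rho_h\frac{\partial\Phi_h}{\partial r}\Big)\psi\,r^2dr+s_j^{[2],\mathrm{cor}},$$ $$s_j^{[2],\mathrm{cor}}=r_{j+1/2}^2p^d(r_{j+1/2})\psi^-_{j+1/2}-r_{j-1/2}^2p^d(r_{j-1/2})\psi^+_{j-1/2}-\int_{K_j}p_h^e(\partial_r\psi)r^2dr-\int_{K_j}\Big(\frac{2p_h^e}{r}-\rho_h^e\frac{\partial\Phi_h^e}{\partial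 r}\Big)\psi\,r^2dr,$$ and, for a function $q$ (standing for an approximation of $\partial_t\rho$) and a potential $\Phi$, $$s_j^{[3],\mathrm{tec}}(\boldsymbol{u}_h,\hat{\boldsymbol{f}}^*,q,\Phi,\delta)=-\left.\big(\hat{f}^{*,[1]}\,\Phi\,\delta\,r^2\big)\right|_{r_{j-1/2}^+}^{r_{j+1/2}^-}-\int_{K_j}q\,\Phi\,\delta\,r^2dr+\int_{K_j}(\rho u)_h\,\Phi\,\frac{\partial\delta}{\partial r}\,r^2dr.$$ *)

theory Defs
  imports "HOL-Analysis.Analysis" "HOL-Computational_Algebra.Polynomial"
begin

text \<open>
  Conservative states \<open>(\<rho>, \<rho>u, E)\<close> are vectors in \<open>real^3\<close>, so \<open>w $ i\<close> is the
  \<open>i\<close>-th component and \<open>\<bullet>\<close> the dot product.  The interface \<open>r\<^bsub>j+1/2\<^esub>\<close> is written \<open>x j\<close>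
  (\<open>j = 0..N\<close>); cell \<open>j\<close> (\<open>j = 1..N\<close>) is the interval from \<open>x (j - 1)\<close> to \<open>x j\<close>.
  All integrals are Henstock--Kurzweil integrals.
\<close>

section \<open>Euler equations\<close>

definition velocity :: "real^3 \<Rightarrow> real" where
  "velocity w = w $ 2 / w $ 1"

definition pressure :: "real \<Rightarrow> real^3 \<Rightarrow> real" where
  "pressure \<gamma> w = (\<gamma> - 1) * (w $ 3 - 1/2 * w $ 1 * (velocity w)\<^sup>2)"

definition sound_speed :: "real \<Rightarrow> real^3 \<Rightarrow> real" where
  "sound_speed \<gamma> w = sqrt (\<gamma> * pressure \<gamma> w / w $ 1)"

definition euler_flux :: "real \<Rightarrow> real^3 \<Rightarrow> real^3" where
  "euler_flux \<gamma> w = vector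
     [w $ 2,
      w $ 1 * (velocity w)\<^sup>2 + pressure \<gamma> w,
      (w $ 3 + pressure \<gamma> w) * velocity w]"

section \<open>HLLC flux\<close>

definition S_minus :: "real \<Rightarrow> real^3 \<Rightarrow> real^3 \<Rightarrow> real" where
  "S_minus \<gamma> wl wr =
     min (velocity wl - sound_speed \<gamma> wl) (velocity wr - sound_speed \<gamma> wr)"

definition S_plus :: "real \<Rightarrow> real^3 \<Rightarrow> real^3 \<Rightarrow> real" where
  "S_plus \<gamma> wl wr =
     max (velocity wl + sound_speed \<gamma> wl) (velocity wr + sound_speed \<gamma> wr)"

definition S_star :: "real \<Rightarrow> real^3 \<Rightarrow> real^3 \<Rightarrow> real" where
  "S_star \<gamma> wl wr =
     (let Sm = S_minus \<gamma> wl wr; Sp = S_plus \<gamma> wl wr in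
      (pressure \<gamma> wr - pressure \<gamma> wl
         + wl $ 1 * velocity wl * (Sm - velocity wl)
         - wr $ 1 * velocity wr * (Sp - velocity wr))
      / (wl $ 1 * (Sm - velocity wl) - wr $ 1 * (Sp - velocity wr)))"

definition star_state :: "real \<Rightarrow> real \<Rightarrow> real \<Rightarrow> real^3 \<Rightarrow> real^3" where
  "star_state \<gamma> S Ss w =
     (w $ 1 * ((S - velocity w) / (S - Ss))) *\<^sub>R vector
       [1,
        Ss,
        w $ 3 / w $ 1 + (Ss - velocity w) *
          (Ss + pressure \<gamma> w / (w $ 1 * (S - velocity w)))]"

definition hllc :: "real \<Rightarrow> real^3 \<Rightarrow> real^3 \<Rightarrow> real^3" where
  "hllc \<gamma> wl wr =
     (let Sm = S_minus \<gamma> wl wr; Sp = S_plus \<gamma> wl wr; Ss = S_star \<gamma> wl wr in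
      if 0 \<le> Sm then euler_flux \<gamma> wl
      else if 0 \<le> Ss then euler_flux \<gamma> wl + Sm *\<^sub>R (star_state \<gamma> Sm Ss wl - wl)
      else if 0 \<le> Sp then euler_flux \<gamma> wr + Sp *\<^sub>R (star_state \<gamma> Sp Ss wr - wr)
      else euler_flux \<gamma> wr)"

section \<open>Mesh and discontinuous Galerkin spaces\<close>

definition mesh :: "nat \<Rightarrow> real \<Rightarrow> (nat \<Rightarrow> real) \<Rightarrow> bool" where
  "mesh N R x \<longleftrightarrow> 1 \<le> N \<and> x 0 = 0 \<and> x N = R \<and> (\<forall>j<N. x j < x (Suc j))"

definition cell :: "(nat \<Rightarrow> real) \<Rightarrow> nat \<Rightarrow> real set" where
  "cell x j = {x (j - 1)..x j}"

text \<open>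
  Members of \<open>V\<^sub>h\<close> are represented by functions that are polynomial on the open cells;
  their values at the finitely many interfaces are arbitrary and are never used (only
  one-sided limits and integrals are).  Square integrability on \<open>[0,R]\<close> is automatic.
\<close>

definition Vh :: "nat \<Rightarrow> nat \<Rightarrow> (nat \<Rightarrow> real) \<Rightarrow> (real \<Rightarrow> real) set" where
  "Vh k N x = {v. \<forall>j\<in>{1..N}. \<exists>p :: real poly.
     degree p \<le> k \<and> (\<forall>s\<in>{x (j - 1)<..<x j}. v s = poly p s)}"

definition Pih :: "nat \<Rightarrow> nat \<Rightarrow> (nat \<Rightarrow> real) \<Rightarrow> (real \<Rightarrow> real^3) set" where
  "Pih k N x = {v. \<forall>i. (\<lambda>s. v s $ i) \<in> Vh k N x}"

definition trace_left :: "(real \<Rightarrow> 'a::t2_space) \<Rightarrow> real \<Rightarrow> 'a" where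
  "trace_left v s = Lim (at_left s) v"

definition trace_right :: "(real \<Rightarrow> 'a::t2_space) \<Rightarrow> real \<Rightarrow> 'a" where
  "trace_right v s = Lim (at_right s) v"

text \<open>Positivity on every closed cell, with the one-sided limits as end point values.\<close>

definition positive_on_cells :: "nat \<Rightarrow> (nat \<Rightarrow> real) \<Rightarrow> (real \<Rightarrow> real) \<Rightarrow> bool" where
  "positive_on_cells N x v \<longleftrightarrow> (\<forall>j\<in>{1..N}.
     (\<forall>s\<in>{x (j - 1)<..<x j}. 0 < v s) \<and>
     0 < trace_right v (x (j - 1)) \<and> 0 < trace_left v (x j))"

text \<open>
  Gauss--Radau projection.  The defining conditions determine it up to the irrelevant values
  at the interfaces, hence the choice operator.
\<close>

definition is_radau ::
  "nat \<Rightarrow> nat \<Rightarrow> (nat \<Rightarrow> real) \<Rightarrow> (real \<Rightarrow> real) \<Rightarrow> (real \<Rightarrow> real) \<Rightarrow> bool" where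
  "is_radau k N x w v \<longleftrightarrow> v \<in> Vh k N x \<and> (\<forall>j\<in>{1..N}.
     (\<forall>q :: real poly. degree q \<le> k - 1 \<longrightarrow>
        integral (cell x j) (\<lambda>s. v s * poly q s) = integral (cell x j) (\<lambda>s. w s * poly q s)) \<and>
     trace_right v (x (j - 1)) = trace_right w (x (j - 1)))"

definition radau ::
  "nat \<Rightarrow> nat \<Rightarrow> (nat \<Rightarrow> real) \<Rightarrow> (real \<Rightarrow> real) \<Rightarrow> (real \<Rightarrow> real)" where
  "radau k N x w = (SOME v. is_radau k N x w v)"

definition radau_vec ::
  "nat \<Rightarrow> nat \<Rightarrow> (nat \<Rightarrow> real) \<Rightarrow> (real \<Rightarrow> real^3) \<Rightarrow> (real \<Rightarrow> real^3)" where
  "radau_vec k N x w = (\<lambda>s. \<chi> i. radau k N x (\<lambda>t. w t $ i) s)"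

section \<open>Gravitational potential\<close>

definition dPhi :: "real \<Rightarrow> (real \<Rightarrow> real) \<Rightarrow> real \<Rightarrow> real" where
  "dPhi G \<rho> r =
     (if r = 0 then 0 else 4 * pi * G / r\<^sup>2 * integral {0..r} (\<lambda>\<tau>. \<rho> \<tau> * \<tau>\<^sup>2))"

text \<open>The argument \<open>b\<close> is the prescribed value at the outer boundary \<open>R\<close>.\<close>

definition Phi :: "real \<Rightarrow> real \<Rightarrow> real \<Rightarrow> (real \<Rightarrow> real) \<Rightarrow> real \<Rightarrow> real" where
  "Phi G R b \<rho> r = b - integral {r..R} (dPhi G \<rho>)"

section \<open>Equilibrium recovery\<close>

text \<open>\<open>\<theta>\<close> solves the Lane--Emden problem of index \<open>m\<close> on \<open>[0, X]\<close>.\<close>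

definition lane_emden :: "real \<Rightarrow> real \<Rightarrow> (real \<Rightarrow> real) \<Rightarrow> bool" where
  "lane_emden m X \<theta> \<longleftrightarrow> \<theta> 0 = 1 \<and>
     (\<exists>\<theta>'. \<theta>' 0 = 0 \<and>
       (\<forall>\<xi>\<in>{0..X}. (\<theta> has_real_derivative \<theta>' \<xi>) (at \<xi> within {0..X})) \<and>
       (\<forall>\<xi>\<in>{0<..X}. \<exists>D.
          ((\<lambda>s. s\<^sup>2 * \<theta>' s) has_real_derivative D) (at \<xi> within {0..X}) \<and>
          D / \<xi>\<^sup>2 = - (\<theta> \<xi> powr m)))"

definition rho0 :: "(real \<Rightarrow> real^3) \<Rightarrow> real" where
  "rho0 u = trace_right u 0 $ 1"

definition p0 :: "real \<Rightarrow> (real \<Rightarrow> real^3) \<Rightarrow> real" where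
  "p0 \<gamma> u = pressure \<gamma> (trace_right u 0)"

definition kappa0 :: "real \<Rightarrow> (real \<Rightarrow> real^3) \<Rightarrow> real" where
  "kappa0 \<gamma> u = p0 \<gamma> u / rho0 u powr \<gamma>"

definition alpha :: "real \<Rightarrow> real \<Rightarrow> (real \<Rightarrow> real^3) \<Rightarrow> real" where
  "alpha \<gamma> G u =
     sqrt (\<gamma> / (\<gamma> - 1) * kappa0 \<gamma> u * rho0 u powr (\<gamma> - 2) / (4 * pi * G))"

definition u_d :: "real \<Rightarrow> real \<Rightarrow> (real \<Rightarrow> real) \<Rightarrow> (real \<Rightarrow> real^3) \<Rightarrow> real \<Rightarrow> real^3" where
  "u_d \<gamma> G \<theta> u r = vector
     [rho0 u * \<theta> (r / alpha \<gamma> G u) powr (1 / (\<gamma> - 1)),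
      0,
      kappa0 \<gamma> u / (\<gamma> - 1) * rho0 u powr \<gamma> * \<theta> (r / alpha \<gamma> G u) powr (\<gamma> / (\<gamma> - 1))]"

definition p_d :: "real \<Rightarrow> real \<Rightarrow> (real \<Rightarrow> real) \<Rightarrow> (real \<Rightarrow> real^3) \<Rightarrow> real \<Rightarrow> real" where
  "p_d \<gamma> G \<theta> u r = kappa0 \<gamma> u * (u_d \<gamma> G \<theta> u r $ 1) powr \<gamma>"

definition u_e ::
  "real \<Rightarrow> real \<Rightarrow> nat \<Rightarrow> nat \<Rightarrow> (nat \<Rightarrow> real) \<Rightarrow> (real \<Rightarrow> real) \<Rightarrow> (real \<Rightarrow> real^3)
     \<Rightarrow> real \<Rightarrow> real^3" where
  "u_e \<gamma> G k N x \<theta> u = radau_vec k N x (u_d \<gamma> G \<theta> u)"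

definition u_f ::
  "real \<Rightarrow> real \<Rightarrow> nat \<Rightarrow> nat \<Rightarrow> (nat \<Rightarrow> real) \<Rightarrow> (real \<Rightarrow> real) \<Rightarrow> (real \<Rightarrow> real^3)
     \<Rightarrow> real \<Rightarrow> real^3" where
  "u_f \<gamma> G k N x \<theta> u s = u s - u_e \<gamma> G k N x \<theta> u s"

section \<open>Numerical flux\<close>

text \<open>\<open>gl\<close> and \<open>gr\<close> are the exterior states supplied by the boundary conditions at
  \<open>r = 0\<close> and \<open>r = R\<close>.\<close>

definition u_star_minus ::
  "real \<Rightarrow> real \<Rightarrow> nat \<Rightarrow> nat \<Rightarrow> (nat \<Rightarrow> real) \<Rightarrow> (real \<Rightarrow> real) \<Rightarrow> real^3
     \<Rightarrow> (real \<Rightarrow> real^3) \<Rightarrow> nat \<Rightarrow> real^3" where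
  "u_star_minus \<gamma> G k N x \<theta> gl u j =
     (if j = 0 then gl
      else u_d \<gamma> G \<theta> u (x j) + trace_left (u_f \<gamma> G k N x \<theta> u) (x j))"

definition u_star_plus ::
  "real \<Rightarrow> real \<Rightarrow> nat \<Rightarrow> nat \<Rightarrow> (nat \<Rightarrow> real) \<Rightarrow> (real \<Rightarrow> real) \<Rightarrow> real^3
     \<Rightarrow> (real \<Rightarrow> real^3) \<Rightarrow> nat \<Rightarrow> real^3" where
  "u_star_plus \<gamma> G k N x \<theta> gr u j =
     (if j = N then gr
      else u_d \<gamma> G \<theta> u (x j) + trace_right (u_f \<gamma> G k N x \<theta> u) (x j))"

definition num_flux ::
  "real \<Rightarrow> real \<Rightarrow> nat \<Rightarrow> nat \<Rightarrow> (nat \<Rightarrow> real) \<Rightarrow> (real \<Rightarrow> real) \<Rightarrow> real^3 \<Rightarrow> real^3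
     \<Rightarrow> (real \<Rightarrow> real^3) \<Rightarrow> nat \<Rightarrow> real^3" where
  "num_flux \<gamma> G k N x \<theta> gl gr u j =
     hllc \<gamma> (u_star_minus \<gamma> G k N x \<theta> gl u j) (u_star_plus \<gamma> G k N x \<theta> gr u j)"

section \<open>Scheme operators\<close>

text \<open>The argument \<open>fs\<close> is the family of interface fluxes, \<open>fs j\<close> being the one at \<open>x j\<close>.\<close>

definition F_op ::
  "real \<Rightarrow> (nat \<Rightarrow> real) \<Rightarrow> (nat \<Rightarrow> real^3) \<Rightarrow> nat \<Rightarrow> (real \<Rightarrow> real^3) \<Rightarrow> (real \<Rightarrow> real^3)
     \<Rightarrow> real" where
  "F_op \<gamma> x fs j u v =
     - (x j)\<^sup>2 * (fs j \<bullet> trace_left v (x j))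
     + (x (j - 1))\<^sup>2 * (fs (j - 1) \<bullet> trace_right v (x (j - 1)))
     + integral (cell x j) (\<lambda>s. (euler_flux \<gamma> (u s) \<bullet> vector_derivative v (at s)) * s\<^sup>2)"

definition s2_cor ::
  "real \<Rightarrow> real \<Rightarrow> nat \<Rightarrow> nat \<Rightarrow> (nat \<Rightarrow> real) \<Rightarrow> (real \<Rightarrow> real) \<Rightarrow> nat \<Rightarrow> (real \<Rightarrow> real^3)
     \<Rightarrow> (real \<Rightarrow> real) \<Rightarrow> real" where
  "s2_cor \<gamma> G k N x \<theta> j u \<psi> =
     (let ue = u_e \<gamma> G k N x \<theta> u; pe = (\<lambda>s. pressure \<gamma> (ue s)); re = (\<lambda>s. ue s $ 1) in
      (x j)\<^sup>2 * p_d \<gamma> G \<theta> u (x j) * trace_left \<psi> (x j)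
      - (x (j - 1))\<^sup>2 * p_d \<gamma> G \<theta> u (x (j - 1)) * trace_right \<psi> (x (j - 1))
      - integral (cell x j) (\<lambda>s. pe s * deriv \<psi> s * s\<^sup>2)
      - integral (cell x j) (\<lambda>s. (2 * pe s / s - re s * dPhi G re s) * \<psi> s * s\<^sup>2))"

definition s2_wb ::
  "real \<Rightarrow> real \<Rightarrow> nat \<Rightarrow> nat \<Rightarrow> (nat \<Rightarrow> real) \<Rightarrow> (real \<Rightarrow> real) \<Rightarrow> nat \<Rightarrow> (real \<Rightarrow> real^3)
     \<Rightarrow> (real \<Rightarrow> real) \<Rightarrow> real" where
  "s2_wb \<gamma> G k N x \<theta> j u \<psi> =
     integral (cell x j)
       (\<lambda>s. (2 * pressure \<gamma> (u s) / s - u s $ 1 * dPhi G (\<lambda>t. u t $ 1) s) * \<psi> s * s\<^sup>2)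
     + s2_cor \<gamma> G k N x \<theta> j u \<psi>"

definition s3_tec ::
  "(nat \<Rightarrow> real) \<Rightarrow> (nat \<Rightarrow> real^3) \<Rightarrow> nat \<Rightarrow> (real \<Rightarrow> real^3) \<Rightarrow> (real \<Rightarrow> real)
     \<Rightarrow> (real \<Rightarrow> real) \<Rightarrow> (real \<Rightarrow> real) \<Rightarrow> real" where
  "s3_tec x fs j u q \<Phi> \<delta> =
     - (fs j $ 1 * trace_left \<Phi> (x j) * trace_left \<delta> (x j) * (x j)\<^sup>2
        - fs (j - 1) $ 1 * trace_right \<Phi> (x (j - 1)) * trace_right \<delta> (x (j - 1)) * (x (j - 1))\<^sup>2)
     - integral (cell x j) (\<lambda>s. q s * \<Phi> s * \<delta> s * s\<^sup>2)
     + integral (cell x j) (\<lambda>s. u s $ 2 * \<Phi> s * deriv \<delta> s * s\<^sup>2)"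

end

theory Submission imports Defs begin

text \<open>
  Testing the scheme with the constant \<open>(0, 0, 1)\<close> leaves only the energy fluxes
  \<open>f\<^sub>3\<close> and the gravitational source, which contains the mass fluxes \<open>f\<^sub>1\<close>.
  With \<open>A\<close> the mean of the two potentials, which is continuous, the interface terms are differences of \<open>r\<^sup>2 (f\<^sub>3 + f\<^sub>1 A)\<close> and telescope over the cells; the two
  remaining boundary terms vanish because \<open>r = 0\<close> at the centre, and because \<open>f\<^sub>3\<close> and \<open>A\<close> vanish
  at \<open>R\<close>.  Hence \<open>E\<close> changes by minus the integral of \<open>(\<rho>\<^sub>1 - \<rho>\<^sub>0) A r\<^sup>2\<close>, and
  \<open>\<rho>\<^sub>1 \<Phi>\<^sub>1 - \<rho>\<^sub>0 \<Phi>\<^sub>0 = 2 (\<rho>\<^sub>1 - \<rho>\<^sub>0) A - (\<rho>\<^sub>1 \<Phi>\<^sub>0 - \<rho>\<^sub>0 \<Phi>\<^sub>1)\<close>.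

  It remains to see that the integral of \<open>(\<rho>\<^sub>1 \<Phi>\<^sub>0 - \<rho>\<^sub>0 \<Phi>\<^sub>1) r\<^sup>2\<close> vanishes, that is, that the
  gravitational interaction energy is symmetric (lemma \<open>gravity_symmetric\<close>).  With
  \<open>M\<^sub>i(r)\<close> the integral of \<open>\<rho>\<^sub>i \<tau>\<^sup>2\<close> over \<open>[0,r]\<close>, integration by parts turns the integral of
  \<open>\<rho>\<^sub>0 r\<^sup>2 \<Phi>\<^sub>1\<close> into minus that of \<open>4 \<pi> G M\<^sub>0 M\<^sub>1 / r\<^sup>2\<close>, which is symmetric in the indices;
  the boundary terms vanish since \<open>M\<^sub>0(0) = 0\<close> and \<open>\<Phi>\<^sub>1(R) = 0\<close>.
\<close>

section \<open>Integration over the mesh\<close>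

lemma mesh_less:
  assumes "mesh N R x" "i < j" "j \<le> N"
  shows "x i < x j"
  using assms(2,3)
proof (induction j)
  case (Suc j)
  have "x j < x (Suc j)" using assms(1) Suc.prems by (simp add: mesh_def)
  with Suc show ?case by (cases "i = j") (auto intro: less_trans)
qed simp

lemma mesh_le:
  assumes "mesh N R x" "i \<le> j" "j \<le> N"
  shows "x i \<le> x j"
  using mesh_less[OF assms(1), of i j] assms(2,3) by (cases "i = j") auto

lemma mesh_combine:
  fixes f :: "real \<Rightarrow> real"
  assumes m: "mesh N R x"
    and f: "\<And>j. j \<in> {1..N} \<Longrightarrow> f integrable_on cell x j"
  shows "f integrable_on {0..R}"
    and "integral {0..R} f = (\<Sum>j=1..N. integral (cell x j) f)"
proof -
  have x0: "x 0 = 0" and xN: "x N = R" using m by (auto simp: mesh_def)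
  have "f integrable_on {0..x n} \<and> integral {0..x n} f = (\<Sum>j=1..n. integral (cell x j) f)"
    if "n \<le> N" for n
    using that
  proof (induction n)
    case 0
    show ?case using integrable_on_refl[of f 0] by (simp add: x0)
  next
    case (Suc n)
    have le: "0 \<le> x n" "x n \<le> x (Suc n)"
      using mesh_le[OF m, of 0 n] mesh_le[OF m, of n "Suc n"] Suc.prems x0 by auto
    have c: "f integrable_on {x n..x (Suc n)}" "cell x (Suc n) = {x n..x (Suc n)}"
      using f[of "Suc n"] Suc.prems by (auto simp: cell_def)
    have i: "f integrable_on {0..x (Suc n)}"
      using Henstock_Kurzweil_Integration.integrable_combine[OF le] Suc c by auto
    moreover have "integral {0..x (Suc n)} f = integral {0..x n} f + integral {x n..x (Suc n)} f"
      using Henstock_Kurzweil_Integration.integral_combine[OF le i] by simp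
    ultimately show ?case using Suc c by simp
  qed
  from this[of N] show "f integrable_on {0..R}"
    "integral {0..R} f = (\<Sum>j=1..N. integral (cell x j) f)" by (auto simp: xN)
qed

lemma Vh_times_continuous_integrable_cell:
  assumes m: "mesh N R x" and v: "v \<in> Vh k N x" and g: "continuous_on {0..R} g"
    and j: "j \<in> {1..N}"
  shows "(\<lambda>s. v s * g s) integrable_on cell x j"
proof -
  from v j obtain p :: "real poly" where p: "\<And>s. s \<in> {x (j - 1)<..<x j} \<Longrightarrow> v s = poly p s"
    unfolding Vh_def by blast
  have "x 0 \<le> x (j - 1)" "x j \<le> x N"
    using mesh_le[OF m] j by auto
  then have "{x (j - 1)..x j} \<subseteq> {0..R}" using m by (auto simp: mesh_def)
  then have "continuous_on {x (j - 1)..x j} (\<lambda>s. poly p s * g s)"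
    by (intro continuous_intros continuous_on_subset[OF g])
  then have i: "(\<lambda>s. poly p s * g s) integrable_on {x (j - 1)..x j}"
    by (rule integrable_continuous_real)
  show ?thesis unfolding cell_def
    by (rule integrable_spike_finite[OF _ _ i, of "{x (j - 1), x j}"]) (auto simp: p)
qed

lemma Vh_times_continuous_integrable:
  assumes "mesh N R x" "v \<in> Vh k N x" "continuous_on {0..R} g"
  shows "(\<lambda>s. v s * g s) integrable_on {0..R}"
  by (rule mesh_combine(1)[OF assms(1)]) (rule Vh_times_continuous_integrable_cell[OF assms])

lemma mesh_locate:
  assumes m: "mesh N R x" and s: "s \<in> {0..R}" "s \<notin> x ` {0..N}"
  obtains j where "j \<in> {1..N}" "s \<in> {x (j - 1)<..<x j}"
proof -
  have x0: "x 0 = 0" and xN: "x N = R" using m by (auto simp: mesh_def)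
  have "s \<noteq> x N" using s(2) by auto
  then have ex: "s < x N" using s(1) xN by simp
  define j where "j = (LEAST j. s < x j)"
  have j: "s < x j" "j \<le> N" unfolding j_def using ex by (auto intro: LeastI Least_le)
  have "j \<noteq> 0" using j(1) s(1) x0 by (cases "j = 0") auto
  then have "\<not> s < x (j - 1)" unfolding j_def using not_less_Least[of "j - 1" "\<lambda>j. s < x j"]
    by (simp add: j_def)
  moreover have "s \<noteq> x (j - 1)" using s(2) j(2) by auto
  ultimately show thesis using that[of j] j \<open>j \<noteq> 0\<close> by auto
qed

lemma Vh_isCont:
  assumes m: "mesh N R x" and v: "v \<in> Vh k N x" and s: "s \<in> {0..R}" "s \<notin> x ` {0..N}"
  shows "isCont v s"
proof -
  obtain j where j: "j \<in> {1..N}" "s \<in> {x (j - 1)<..<x j}" using mesh_locate[OF m s] .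
  from v j obtain p :: "real poly" where p: "\<And>s. s \<in> {x (j - 1)<..<x j} \<Longrightarrow> v s = poly p s"
    unfolding Vh_def by blast
  have "continuous_on {x (j - 1)<..<x j} v"
    using p by (subst continuous_on_cong[OF refl p]) (auto intro!: continuous_intros)
  then show ?thesis using j(2) by (simp add: continuous_on_eq_continuous_at)
qed

lemma Vh_bounded_near_0:
  assumes m: "mesh N R x" and v: "v \<in> Vh k N x"
  obtains C where "0 \<le> C" "\<And>s. s \<in> {0<..<x 1} \<Longrightarrow> \<bar>v s\<bar> \<le> C"
proof -
  have "1 \<in> {1..N}" and x0: "x 0 = 0" using m by (auto simp: mesh_def)
  then obtain p :: "real poly" where p: "\<And>s. s \<in> {0<..<x 1} \<Longrightarrow> v s = poly p s"
    using v unfolding Vh_def by fastforce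
  have "compact (poly p ` {0..x 1})"
    by (intro compact_continuous_image continuous_intros) auto
  then obtain C where C: "\<And>y. y \<in> poly p ` {0..x 1} \<Longrightarrow> norm y \<le> C"
    using compact_imp_bounded bounded_iff by metis
  show thesis
  proof (rule that[of "max C 0"])
    fix s assume "s \<in> {0<..<x 1}"
    then show "\<bar>v s\<bar> \<le> max C 0" using C[of "poly p s"] p[of s] by auto
  qed simp
qed

section \<open>The discrete potential\<close>

text \<open>The mass, up to the factor \<open>4 \<pi>\<close>, inside radius \<open>r\<close>.\<close>

definition mass :: "(real \<Rightarrow> real) \<Rightarrow> real \<Rightarrow> real" where
  "mass \<rho> r = integral {0..r} (\<lambda>\<tau>. \<rho> \<tau> * \<tau>\<^sup>2)"

lemma mass_0 [simp]: "mass \<rho> 0 = 0"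
  by (simp add: mass_def)

text \<open>For \<open>r = 0\<close> this holds because \<open>x / 0 = 0\<close>.\<close>

lemma dPhi_mass: "dPhi G \<rho> r = 4 * pi * G * mass \<rho> r / r\<^sup>2"
  by (simp add: dPhi_def mass_def)

lemma mass_continuous:
  assumes "mesh N R x" "\<rho> \<in> Vh k N x"
  shows "continuous_on {0..R} (mass \<rho>)"
  unfolding mass_def
  by (intro indefinite_integral_continuous_1 Vh_times_continuous_integrable[OF assms]
      continuous_intros)

lemma mass_derivative:
  assumes m: "mesh N R x" and v: "\<rho> \<in> Vh k N x" and r: "r \<in> {0<..<R} - x ` {0..N}"
  shows "(mass \<rho> has_vector_derivative \<rho> r * r\<^sup>2) (at r)"
proof -
  have i: "(\<lambda>s. \<rho> s * s\<^sup>2) integrable_on {0..R}"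
    by (intro Vh_times_continuous_integrable[OF m v] continuous_intros)
  have "isCont \<rho> r" using r by (intro Vh_isCont[OF m v]) auto
  then have "isCont (\<lambda>s. \<rho> s * s\<^sup>2) r" by (intro continuous_intros)
  then have c: "continuous (at r within {0..R} - {}) (\<lambda>s. \<rho> s * s\<^sup>2)"
    by (rule continuous_at_imp_continuous_at_within)
  have "((\<lambda>u. integral {0..u} (\<lambda>s. \<rho> s * s\<^sup>2)) has_vector_derivative \<rho> r * r\<^sup>2)
      (at r within {0..R} - {})"
    by (rule integral_has_vector_derivative_continuous_at[OF i _ _ c]) (use r in auto)
  moreover have "at r within {0..R} = at r"
    using r by (intro at_within_interior) auto
  ultimately show ?thesis by (simp add: mass_def[abs_def])
qed

text \<open>
  At the centre the mass is \<open>O(r\<^sup>3)\<close>, since the density is bounded there, so the field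
  \<open>mass / r\<^sup>2\<close> tends to its prescribed value \<open>0\<close>.
\<close>

lemma dPhi_continuous:
  assumes m: "mesh N R x" and v: "\<rho> \<in> Vh k N x"
  shows "continuous_on {0..R} (dPhi G \<rho>)"
proof -
  have x1: "0 < x 1" "x 1 \<le> R"
    using mesh_less[OF m, of 0 1] mesh_le[OF m, of 1 N] m by (auto simp: mesh_def)
  obtain C where C: "0 \<le> C" "\<And>s. s \<in> {0<..<x 1} \<Longrightarrow> \<bar>\<rho> s\<bar> \<le> C"
    by (rule Vh_bounded_near_0[OF m v]) blast
  have bd: "\<bar>dPhi G \<rho> r\<bar> \<le> 4 * pi * \<bar>G\<bar> * C * r" if r: "r \<in> {0<..<x 1}" for r
  proof -
    have "(\<lambda>s. \<rho> s * s\<^sup>2) integrable_on {0..r}"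
      by (rule integrable_on_subinterval[of _ "{0..R}"])
         (use r x1 in \<open>auto intro!: Vh_times_continuous_integrable[OF m v] continuous_intros\<close>)
    moreover have "norm (\<rho> s * s\<^sup>2) \<le> C * r\<^sup>2" if "s \<in> {0..r}" for s
    proof (cases "s = 0")
      case False
      then have "\<bar>\<rho> s\<bar> \<le> C" "s\<^sup>2 \<le> r\<^sup>2" using that r C(2)[of s] by (auto intro: power_mono)
      then show ?thesis by (auto simp: abs_mult intro: mult_mono C(1))
    qed (use C(1) in simp)
    ultimately have "norm (mass \<rho> r) \<le> integral {0..r} (\<lambda>_. C * r\<^sup>2)"
      unfolding mass_def by (intro integral_norm_bound_integral) auto
    also have "\<dots> = C * r\<^sup>2 * r" using r by simp
    finally have "norm (mass \<rho> r) \<le> C * r\<^sup>2 * r" .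
    then have "\<bar>mass \<rho> r\<bar> / r\<^sup>2 \<le> C * r"
      using r by (simp add: divide_le_eq power2_eq_square mult_ac)
    then have "4 * pi * \<bar>G\<bar> * (\<bar>mass \<rho> r\<bar> / r\<^sup>2) \<le> 4 * pi * \<bar>G\<bar> * (C * r)"
      by (intro mult_left_mono) auto
    then show ?thesis by (simp add: dPhi_mass abs_mult mult_ac)
  qed
  have "(dPhi G \<rho> \<longlongrightarrow> 0) (at_right 0)"
  proof (rule Lim_null_comparison)
    show "\<forall>\<^sub>F r in at_right 0. norm (dPhi G \<rho> r) \<le> 4 * pi * \<bar>G\<bar> * C * r"
      using eventually_at_right_less[of 0] eventually_at_right_real[OF x1(1)]
      by eventually_elim (use bd in auto)
    have "((\<lambda>r. 4 * pi * \<bar>G\<bar> * C * r) \<longlongrightarrow> 4 * pi * \<bar>G\<bar> * C * 0) (at_right 0)"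
      by (intro tendsto_intros)
    then show "((\<lambda>r. 4 * pi * \<bar>G\<bar> * C * r) \<longlongrightarrow> 0) (at_right 0)" by simp
  qed
  moreover have "at 0 within {0..R} = at_right (0::real)"
    using x1 by (intro at_within_Icc_at_right) auto
  ultimately have "continuous (at 0 within {0..R}) (dPhi G \<rho>)"
    by (simp add: continuous_within dPhi_mass)
  moreover have "continuous (at r within {0..R}) (dPhi G \<rho>)" if "r \<in> {0..R}" "r \<noteq> 0" for r
  proof -
    have "continuous (at r within {0..R}) (mass \<rho>)"
      using mass_continuous[OF m v] that by (simp add: continuous_on_eq_continuous_within)
    then have "continuous (at r within {0..R}) (\<lambda>r. 4 * pi * G * mass \<rho> r / r\<^sup>2)"
      using that by (intro continuous_intros) auto
    then show ?thesis by (simp add: dPhi_mass[abs_def])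
  qed
  ultimately show ?thesis unfolding continuous_on_eq_continuous_within by blast
qed

lemma Phi_continuous:
  assumes "mesh N R x" "\<rho> \<in> Vh k N x"
  shows "continuous_on {0..R} (Phi G R b \<rho>)"
  unfolding Phi_def
  by (intro continuous_intros indefinite_integral_continuous_1' integrable_continuous_real
      dPhi_continuous[OF assms])

lemma Phi_derivative:
  assumes m: "mesh N R x" and v: "\<rho> \<in> Vh k N x" and r: "r \<in> {0<..<R}"
  shows "(Phi G R b \<rho> has_vector_derivative dPhi G \<rho> r) (at r)"
proof -
  have "((\<lambda>u. integral {u..R} (dPhi G \<rho>)) has_vector_derivative - dPhi G \<rho> r) (at r within {0..R})"
    by (rule integral_has_vector_derivative'[OF dPhi_continuous[OF m v]]) (use r in auto)
  then have "((\<lambda>u. b - integral {u..R} (dPhi G \<rho>)) has_vector_derivative 0 - - dPhi G \<rho> r)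
      (at r within {0..R})"
    by (intro has_vector_derivative_diff has_vector_derivative_const)
  moreover have "at r within {0..R} = at r"
    using r by (intro at_within_interior) auto
  ultimately show ?thesis by (simp add: Phi_def[abs_def])
qed

text \<open>
  The density may jump at the interfaces, so \<open>mass a\<close> is differentiable only off this finite
  set; as \<open>mass a\<close> is continuous, integration by parts still holds across it.
\<close>

lemma gravity_by_parts:
  assumes m: "mesh N R x" and a: "a \<in> Vh k N x" and b: "b \<in> Vh k N x"
    and R: "Phi G R c b R = 0"
  shows "integral {0..R} (\<lambda>s. a s * Phi G R c b s * s\<^sup>2)
       = - integral {0..R} (\<lambda>s. mass a s * dPhi G b s)"
proof -
  have R0: "0 \<le> R" using mesh_le[OF m, of 0 N] m by (auto simp: mesh_def)
  have "(\<lambda>s. mass a s * dPhi G b s) integrable_on {0..R}"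
    by (intro integrable_continuous_real continuous_intros mass_continuous[OF m a]
        dPhi_continuous[OF m b])
  then have i: "((\<lambda>s. mass a s * dPhi G b s) has_integral
      mass a R * Phi G R c b R - mass a 0 * Phi G R c b 0
      - (- integral {0..R} (\<lambda>s. mass a s * dPhi G b s))) {0..R}"
    using R by (simp add: has_integral_integral)
  have "((\<lambda>s. (a s * s\<^sup>2) * Phi G R c b s) has_integral
      - integral {0..R} (\<lambda>s. mass a s * dPhi G b s)) {0..R}"
    by (rule integration_by_parts_interior_strong[OF bounded_bilinear_mult, of "x ` {0..N}",
          OF _ R0 mass_continuous[OF m a] Phi_continuous[OF m b] _ _ i])
       (use mass_derivative[OF m a] Phi_derivative[OF m b] in auto)
  then have "integral {0..R} (\<lambda>s. (a s * s\<^sup>2) * Phi G R c b s)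
      = - integral {0..R} (\<lambda>s. mass a s * dPhi G b s)"
    by (rule integral_unique)
  then show ?thesis by (simp add: mult_ac)
qed

lemma gravity_symmetric:
  assumes m: "mesh N R x" and a: "a \<in> Vh k N x" and b: "b \<in> Vh k N x"
    and "Phi G R c b R = 0" and "Phi G R d a R = 0"
  shows "integral {0..R} (\<lambda>s. a s * Phi G R c b s * s\<^sup>2)
       = integral {0..R} (\<lambda>s. b s * Phi G R d a s * s\<^sup>2)"
  using gravity_by_parts[OF m a b] gravity_by_parts[OF m b a] assms(4,5)
  by (simp add: dPhi_mass mult_ac)

section \<open>The energy test function\<close>

lemma trace_left_const [simp]: "trace_left (\<lambda>_. c) (s::real) = c"
  unfolding trace_left_def by (rule tendsto_Lim) auto

lemma trace_right_const [simp]: "trace_right (\<lambda>_. c) (s::real) = c"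
  unfolding trace_right_def by (rule tendsto_Lim) auto

lemma trace_left_continuous:
  fixes g :: "real \<Rightarrow> real"
  assumes "continuous_on {a..b} g" "s \<in> {a<..b}"
  shows "trace_left g s = g s"
proof -
  have "continuous_on {a..s} g" using assms by (auto intro: continuous_on_subset)
  then have "(g \<longlongrightarrow> g s) (at_left s)" using assms(2) by (auto intro: continuous_on_Icc_at_leftD)
  then show ?thesis unfolding trace_left_def by (intro tendsto_Lim) auto
qed

lemma trace_right_continuous:
  fixes g :: "real \<Rightarrow> real"
  assumes "continuous_on {a..b} g" "s \<in> {a..<b}"
  shows "trace_right g s = g s"
proof -
  have "continuous_on {s..b} g" using assms by (auto intro: continuous_on_subset)
  then have "(g \<longlongrightarrow> g s) (at_right s)" using assms(2) by (auto intro: continuous_on_Icc_at_rightD)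
  then show ?thesis unfolding trace_right_def by (intro tendsto_Lim) auto
qed

lemma const_in_Pih: "(\<lambda>_. c) \<in> Pih k N x"
proof -
  have "\<exists>p. degree p \<le> k \<and> (\<forall>s\<in>A. c $ i = poly p s)" for i A
    by (rule exI[of _ "[:c $ i:]"]) simp
  then show ?thesis by (simp add: Pih_def Vh_def)
qed

lemma F_op_const_energy:
  "F_op \<gamma> x fs j u (\<lambda>_. axis 3 1) = - (x j)\<^sup>2 * fs j $ 3 + (x (j - 1))\<^sup>2 * fs (j - 1) $ 3"
  by (simp add: F_op_def inner_axis)

lemma s2_wb_zero: "s2_wb \<gamma> G k N x \<theta> j u (\<lambda>_. 0) = 0"
  by (simp add: s2_wb_def s2_cor_def Let_def)

lemma s3_tec_one:
  assumes "mesh N R x" "j \<in> {1..N}" "continuous_on {0..R} A"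
  shows "s3_tec x fs j u q A (\<lambda>_. 1) =
     - (fs j $ 1 * A (x j) * (x j)\<^sup>2 - fs (j - 1) $ 1 * A (x (j - 1)) * (x (j - 1))\<^sup>2)
     - integral (cell x j) (\<lambda>s. q s * A s * s\<^sup>2)"
proof -
  have "0 \<le> x (j - 1)" "x (j - 1) < x j" "x j \<le> R"
    using mesh_le[OF assms(1), of 0 "j - 1"] mesh_less[OF assms(1), of "j - 1" j]
      mesh_le[OF assms(1), of j N] assms(1,2) by (auto simp: mesh_def)
  then have "trace_left A (x j) = A (x j)" "trace_right A (x (j - 1)) = A (x (j - 1))"
    using trace_left_continuous[OF assms(3)] trace_right_continuous[OF assms(3)] by auto
  then show ?thesis by (simp add: s3_tec_def)
qed

section \<open>Conservation of the total energy\<close>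

theorem proposition3p4:
  fixes \<gamma> G R \<Delta>t bn bn1 :: real and k N :: nat and x :: "nat \<Rightarrow> real"
    and un un1 :: "real \<Rightarrow> real^3" and \<theta> :: "real \<Rightarrow> real" and gl gr :: "real^3"
    and fs :: "nat \<Rightarrow> real^3" and \<Phi>n \<Phi>n1 :: "real \<Rightarrow> real"
  assumes "1 < \<gamma>" and "0 < G" and "1 \<le> k" and "mesh N R x" and "0 < \<Delta>t"
    and "un \<in> Pih k N x" and "un1 \<in> Pih k N x"
    and "positive_on_cells N x (\<lambda>s. un s $ 1)"
    and "0 < p0 \<gamma> un"
    and "lane_emden (1 / (\<gamma> - 1)) (R / alpha \<gamma> G un) \<theta>"
    and "\<forall>\<xi>\<in>{0..R / alpha \<gamma> G un}. 0 \<le> \<theta> \<xi>"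
    and "positive_on_cells N x (\<lambda>s. u_e \<gamma> G k N x \<theta> un s $ 1)"
    and "\<forall>j\<in>{0..N}. \<forall>w\<in>{u_star_minus \<gamma> G k N x \<theta> gl un j, u_star_plus \<gamma> G k N x \<theta> gr un j}.
           0 < w $ 1 \<and> 0 < pressure \<gamma> w"
    and "fs = num_flux \<gamma> G k N x \<theta> gl gr un"
    and "\<Phi>n = Phi G R bn (\<lambda>s. un s $ 1)"
    and "\<Phi>n1 = Phi G R bn1 (\<lambda>s. un1 s $ 1)"
    and scheme: "\<forall>j\<in>{1..N}. \<forall>v\<in>Pih k N x.
      integral (cell x j) (\<lambda>s. (un1 s \<bullet> v s) * s\<^sup>2) =
      integral (cell x j) (\<lambda>s. (un s \<bullet> v s) * s\<^sup>2)
      + \<Delta>t * (F_op \<gamma> x fs j un v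
              + s2_wb \<gamma> G k N x \<theta> j un (\<lambda>s. v s $ 2)
              + s3_tec x fs j un (\<lambda>s. (un1 s $ 1 - un s $ 1) / \<Delta>t)
                  (\<lambda>s. (\<Phi>n1 s + \<Phi>n s) / 2) (\<lambda>s. v s $ 3))"
    and "\<Phi>n R = 0" and "\<Phi>n1 R = 0"
    and "fs N $ 3 = 0"
  shows "integral {0..R} (\<lambda>s. (un1 s $ 3 + 1/2 * un1 s $ 1 * \<Phi>n1 s) * s\<^sup>2)
       = integral {0..R} (\<lambda>s. (un s $ 3 + 1/2 * un s $ 1 * \<Phi>n s) * s\<^sup>2)"
proof -
  define A where "A = (\<lambda>s. (\<Phi>n1 s + \<Phi>n s) / 2)"
  \<comment> \<open>\<open>B j\<close> is the total-energy flux through the interface \<open>x j\<close>; it is single-valued because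
    \<open>A\<close> is continuous.\<close>
  define B where "B = (\<lambda>j. (x j)\<^sup>2 * (fs j $ 3 + fs j $ 1 * A (x j)))"
  note m = \<open>mesh N R x\<close>
  have V: "(\<lambda>s. un s $ i) \<in> Vh k N x" "(\<lambda>s. un1 s $ i) \<in> Vh k N x" for i
    using \<open>un \<in> Pih k N x\<close> \<open>un1 \<in> Pih k N x\<close> by (auto simp: Pih_def)
  have cP: "continuous_on {0..R} \<Phi>n" "continuous_on {0..R} \<Phi>n1"
    using Phi_continuous[OF m V(1)[of 1]] Phi_continuous[OF m V(2)[of 1]]
      \<open>\<Phi>n = _\<close> \<open>\<Phi>n1 = _\<close> by auto
  have cA: "continuous_on {0..R} A" unfolding A_def by (intro continuous_intros cP) auto
  note int = Vh_times_continuous_integrable[OF m]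
  note intc = Vh_times_continuous_integrable_cell[OF m]
  note sq = continuous_on_power[OF continuous_on_id, of "{0..R}" 2, unfolded id_def]
  note Asq = continuous_on_mult[OF cA sq]
  \<comment> \<open>Change of the energy density plus the work against the mean potential.\<close>
  let ?H = "\<lambda>s. un1 s $ 3 * s\<^sup>2 - un s $ 3 * s\<^sup>2
    + (un1 s $ 1 * (A s * s\<^sup>2) - un s $ 1 * (A s * s\<^sup>2))"
  have axis3: "(axis 3 1 :: real^3) $ 2 = 0" "(axis 3 1 :: real^3) $ 3 = 1"
    by (simp_all add: axis_def)
  have cell_step: "integral (cell x j) ?H = \<Delta>t * (B (j - 1) - B j)"
    if j: "j \<in> {1..N}" for j
  proof -
    have "integral (cell x j) (\<lambda>s. (un1 s \<bullet> axis 3 1) * s\<^sup>2) =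
      integral (cell x j) (\<lambda>s. (un s \<bullet> axis 3 1) * s\<^sup>2)
      + \<Delta>t * (F_op \<gamma> x fs j un (\<lambda>_. axis 3 1)
              + s2_wb \<gamma> G k N x \<theta> j un (\<lambda>_. (axis 3 1 :: real^3) $ 2)
              + s3_tec x fs j un (\<lambda>s. (un1 s $ 1 - un s $ 1) / \<Delta>t) A (\<lambda>_. (axis 3 1 :: real^3) $ 3))"
      unfolding A_def by (rule scheme[rule_format, OF j const_in_Pih])
    then have e: "integral (cell x j) (\<lambda>s. un1 s $ 3 * s\<^sup>2) =
      integral (cell x j) (\<lambda>s. un s $ 3 * s\<^sup>2)
      + \<Delta>t * (B (j - 1) - B j
          - integral (cell x j) (\<lambda>s. (un1 s $ 1 - un s $ 1) / \<Delta>t * A s * s\<^sup>2))"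
      by (simp add: inner_axis axis3 F_op_const_energy s2_wb_zero
          s3_tec_one[OF m j cA] B_def algebra_simps)
    have "integral (cell x j) (\<lambda>s. (un1 s $ 1 - un s $ 1) / \<Delta>t * A s * s\<^sup>2)
        = integral (cell x j) (\<lambda>s. 1 / \<Delta>t * (un1 s $ 1 * (A s * s\<^sup>2) - un s $ 1 * (A s * s\<^sup>2)))"
      by (rule arg_cong[where f = "integral _"]) (auto simp: algebra_simps diff_divide_distrib)
    also have "\<dots> = 1 / \<Delta>t * integral (cell x j)
        (\<lambda>s. un1 s $ 1 * (A s * s\<^sup>2) - un s $ 1 * (A s * s\<^sup>2))"
      by (rule integral_mult_right)
    finally have "\<Delta>t * integral (cell x j) (\<lambda>s. (un1 s $ 1 - un s $ 1) / \<Delta>t * A s * s\<^sup>2)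
        = integral (cell x j) (\<lambda>s. un1 s $ 1 * (A s * s\<^sup>2) - un s $ 1 * (A s * s\<^sup>2))"
      using \<open>0 < \<Delta>t\<close> by simp
    moreover have "integral (cell x j) ?H
        = integral (cell x j) (\<lambda>s. un1 s $ 3 * s\<^sup>2) - integral (cell x j) (\<lambda>s. un s $ 3 * s\<^sup>2)
          + integral (cell x j) (\<lambda>s. un1 s $ 1 * (A s * s\<^sup>2) - un s $ 1 * (A s * s\<^sup>2))"
      by (intro integral_unique has_integral_add has_integral_diff integrable_integral
          Henstock_Kurzweil_Integration.integrable_diff
          intc[OF V(1) sq j] intc[OF V(2) sq j] intc[OF V(1) Asq j] intc[OF V(2) Asq j])
    ultimately show ?thesis using e by (simp only: right_diff_distrib)
  qed
  have "integral {0..R} ?H = (\<Sum>j=1..N. integral (cell x j) ?H)"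
    by (intro mesh_combine(2)[OF m] Henstock_Kurzweil_Integration.integrable_add
        Henstock_Kurzweil_Integration.integrable_diff
        intc[OF V(1) sq] intc[OF V(2) sq] intc[OF V(1) Asq] intc[OF V(2) Asq])
  also have "\<dots> = (\<Sum>j=1..N. \<Delta>t * (B (j - 1) - B j))"
    by (intro sum.cong refl cell_step)
  also have "\<dots> = \<Delta>t * (B 0 - B N)"
    by (induction N) (auto simp: algebra_simps)
  also have "\<dots> = 0"
    using m \<open>\<Phi>n R = 0\<close> \<open>\<Phi>n1 R = 0\<close> \<open>fs N $ 3 = 0\<close> by (simp add: B_def A_def mesh_def)
  finally have balance: "integral {0..R} ?H = 0" .
  have sym: "integral {0..R} (\<lambda>s. un s $ 1 * (\<Phi>n1 s * s\<^sup>2))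
      = integral {0..R} (\<lambda>s. un1 s $ 1 * (\<Phi>n s * s\<^sup>2))"
    using gravity_symmetric[OF m V(1)[of 1] V(2)[of 1], of G bn1 bn]
      \<open>\<Phi>n R = 0\<close> \<open>\<Phi>n1 R = 0\<close> \<open>\<Phi>n = _\<close> \<open>\<Phi>n1 = _\<close> by (simp add: mult.assoc)
  note Psq = continuous_on_mult[OF cP(1) sq] continuous_on_mult[OF cP(2) sq]
  note i = int[OF V(1)[of 3] sq] int[OF V(2)[of 3] sq]
    int[OF V(1)[of 1] Psq(1)] int[OF V(1)[of 1] Psq(2)]
    int[OF V(2)[of 1] Psq(1)] int[OF V(2)[of 1] Psq(2)]
  note hi = i[THEN integrable_integral]
  note half = has_integral_mult_right[of _ _ _ "1/2 :: real"]
  have E: "((\<lambda>s. (un1 s $ 3 + 1/2 * un1 s $ 1 * \<Phi>n1 s) * s\<^sup>2) has_integral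
      integral {0..R} (\<lambda>s. un1 s $ 3 * s\<^sup>2)
        + 1/2 * integral {0..R} (\<lambda>s. un1 s $ 1 * (\<Phi>n1 s * s\<^sup>2))) {0..R}"
    "((\<lambda>s. (un s $ 3 + 1/2 * un s $ 1 * \<Phi>n s) * s\<^sup>2) has_integral
      integral {0..R} (\<lambda>s. un s $ 3 * s\<^sup>2)
        + 1/2 * integral {0..R} (\<lambda>s. un s $ 1 * (\<Phi>n s * s\<^sup>2))) {0..R}"
    using has_integral_add[OF hi(2) half[OF hi(6)]] has_integral_add[OF hi(1) half[OF hi(3)]]
    by (simp_all add: algebra_simps)
  \<comment> \<open>Expanding \<open>(\<rho>\<^sub>1 - \<rho>\<^sub>0) A\<close> gives the change of \<open>\<rho> \<Phi> / 2\<close> plus the mixed terms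
    \<open>(\<rho>\<^sub>1 \<Phi>\<^sub>0 - \<rho>\<^sub>0 \<Phi>\<^sub>1) / 2\<close>, which cancel by \<open>sym\<close>.\<close>
  have "(?H has_integral
      integral {0..R} (\<lambda>s. un1 s $ 3 * s\<^sup>2) - integral {0..R} (\<lambda>s. un s $ 3 * s\<^sup>2)
      + 1/2 * (integral {0..R} (\<lambda>s. un1 s $ 1 * (\<Phi>n1 s * s\<^sup>2))
             + integral {0..R} (\<lambda>s. un1 s $ 1 * (\<Phi>n s * s\<^sup>2))
             - integral {0..R} (\<lambda>s. un s $ 1 * (\<Phi>n1 s * s\<^sup>2))
             - integral {0..R} (\<lambda>s. un s $ 1 * (\<Phi>n s * s\<^sup>2)))) {0..R}"
    by (rule has_integral_eq[OF _ has_integral_add[OF has_integral_diff[OF hi(2) hi(1)]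
            half[OF has_integral_diff[OF has_integral_diff[OF
              has_integral_add[OF hi(6) hi(5)] hi(4)] hi(3)]]]])
       (simp add: A_def field_simps)
  note H = integral_unique[OF this]
  have arith: "e + 1/2 * a = e' + 1/2 * d"
    if "h = e - e' + 1/2 * (a + b - c - d)" "h = 0" "c = b" for a b c d e e' h :: real
    using that by (simp add: field_simps)
  have "integral {0..R} (\<lambda>s. un1 s $ 3 * s\<^sup>2)
        + 1/2 * integral {0..R} (\<lambda>s. un1 s $ 1 * (\<Phi>n1 s * s\<^sup>2))
      = integral {0..R} (\<lambda>s. un s $ 3 * s\<^sup>2)
        + 1/2 * integral {0..R} (\<lambda>s. un s $ 1 * (\<Phi>n s * s\<^sup>2))"
    by (rule arith[OF H balance sym])
  then show ?thesis using E[THEN integral_unique] by simp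
qed

end
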